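(* Let $(M,f)$ be an isotropic parametric surface in $\mathbb S^3_1(1)$ such that $\Phi=\langle f_{uv},\nu\rangle = 0$ and $$f(w) = \frac{\mu(w)\, W(x(w),y(w)) + \overline{\mu(w)}\, W(y(w),x(w))}{2},$$ with $f_u=\alpha L(x)$ and $f_v=\beta L(y)$. Then the functions $x, y: M \to \mathbb C$ belong to the class of complex functions $Z(w)=\varphi(w)+i\psi(w)$ ($\varphi,\psi$ real valued) such that $$\frac{\partial Z}{\partial v} = i\,\sigma(w)\,\frac{\partial Z}{\partial u},\qquad \text{where } \sigma: M\to\mathbb R \text{ with } \sigma(w)\neq 0 \text{ for all } w\in M$$ ($\sigma$ depending on $Z$). Moreover the following Cauchy–Riemann type equations hold: $$\varphi_u=\frac1\sigma\,\psi_v,\qquad \varphi_v=-\sigma\,\psi_u .$$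
   Context: $\mathbb R^4_1$ is $\mathbb R^4$ with $\langle p,q\rangle=-p^1q^1+p^2q^2+p^3q^3+p^4q^4$, oriented by its canonical basis and time-oriented by the first basis vector; $\mathbb S^3_1(1)=\{p:\langle p,p\rangle=1\}$; $\langle\cdot,\cdot\rangle^{\mathbb C}$ is the complex bilinear extension to $\mathbb C^4$. $M\subset\mathbb C$ is open, connected and simply connected, with points $w=u+iv$; all functions are smooth. An isotropic (parametric, timelike) surface $(M,f)$ of $\mathbb S^3_1(1)$ is a smooth $f:M\to\mathbb R^4_1$, a homeomorphism onto its image, with $\langle f,f\rangle=1$, $f_u,f_v$ linearly independent future directed lightlike vectors (so the induced metric is $2F\,du\,dv$ with $F=\langle f_u,f_v\rangle$). Its Gauss map is $\nu:M\to\mathbb S^3_1(1)$ with $\langle\nu,\nu\rangle=1$, $\langle\nu,f\rangle=\langle\nu,f_u\rangle=\langle\nu,f_v\rangle=0$ and $\{f,f_u,f_v,\nu\}$ positively oriented; it is assumed non-constant. For $x,y\in\mathbb C$, $x\ne y$: $L(x)=(1+x\bar x,\,x+\bar x,\,-i(x-\bar x),\,-1+x\bar x)$ and $W(x,y)=(1+x\bar y,\,x+\bar y,\,-i(x-\bar y),\,-1+x\bar y)$, so $W(y,x)=\overline{W(x,y)}$. Standing representation: there are smooth $\alpha,\beta:M\to\mathbb R$ and $x,y,\mu:M\to\mathbb C$, $x\neq y$ everywhere, with $f_u=\alpha L(x)$, $f_v=\beta L(y)$, $|\mu|^2\langle W(x,y),\overline{W(x,y)}\rangle^{\mathbb C}=2$,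 $f=\frac{1}{2}(\mu W(x,y)+\bar\mu\,\overline{W(x,y)})$ and $\nu=\frac{1}{2i}(\mu W(x,y)-\bar\mu\,\overline{W(x,y)})$.
   Formalization: The claim for x is proved assuming ν_u ≠ 0 on all of M, and the claim for y assuming ν_v ≠ 0 on all of M; with ν merely non-constant the claim fails (x_u can vanish while x_v does not), and these conditions are necessary. *)

theory Defs
  imports "HOL-Analysis.Analysis"
begin

subsection \<open>Smooth functions of \<open>w = u + iv\<close>\<close>

definition du :: "(complex \<Rightarrow> 'b::real_normed_vector) \<Rightarrow> complex \<Rightarrow> 'b" where
  "du g w = vector_derivative (\<lambda>t. g (Complex t (Im w))) (at (Re w))"

definition dv :: "(complex \<Rightarrow> 'b::real_normed_vector) \<Rightarrow> complex \<Rightarrow> 'b" where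
  "dv g w = vector_derivative (\<lambda>t. g (Complex (Re w) t)) (at (Im w))"

text \<open>
  Real differentiability of class \<open>C\<^sup>k\<close> on an open set.  The predicate \<open>differentiable\<close> is
  Frechet differentiability over the reals, also for complex-valued functions.
\<close>

fun C_class :: "nat \<Rightarrow> complex set \<Rightarrow> (complex \<Rightarrow> 'b::real_normed_vector) \<Rightarrow> bool" where
  "C_class 0 M g \<longleftrightarrow> continuous_on M g"
| "C_class (Suc k) M g \<longleftrightarrow>
     (\<forall>w\<in>M. g differentiable (at w)) \<and> C_class k M (du g) \<and> C_class k M (dv g)"

definition smooth_on :: "complex set \<Rightarrow> (complex \<Rightarrow> 'b::real_normed_vector) \<Rightarrow> bool" where
  "smooth_on M g \<longleftrightarrow> (\<forall>k. C_class k M g)"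

subsection \<open>Minkowski space\<close>

text \<open>
  On \<open>real ^ 4\<close> this is the Lorentzian inner product; on \<open>complex ^ 4\<close> it is its complex
  bilinear (not sesquilinear) extension.
\<close>

definition mink :: "'a::comm_ring_1 ^ 4 \<Rightarrow> 'a ^ 4 \<Rightarrow> 'a" where
  "mink p q = - (p $ 1 * q $ 1) + p $ 2 * q $ 2 + p $ 3 * q $ 3 + p $ 4 * q $ 4"

definition complexify :: "real ^ 4 \<Rightarrow> complex ^ 4" where
  "complexify p = (\<chi> i. complex_of_real (p $ i))"

definition lightlike :: "real ^ 4 \<Rightarrow> bool" where
  "lightlike p \<longleftrightarrow> p \<noteq> 0 \<and> mink p p = 0"

text \<open>
  A causal vector lies in the time cone of the first basis vector \<open>axis 1 1\<close> iff its product with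
  that (timelike) vector is negative, i.e. iff its first component is positive.
\<close>

definition future_directed :: "real ^ 4 \<Rightarrow> bool" where
  "future_directed p \<longleftrightarrow> mink p (axis 1 1) < 0"

definition positively_oriented :: "real ^ 4 \<Rightarrow> real ^ 4 \<Rightarrow> real ^ 4 \<Rightarrow> real ^ 4 \<Rightarrow> bool" where
  "positively_oriented a b c d \<longleftrightarrow> det (vector [a, b, c, d] :: real ^ 4 ^ 4) > 0"

subsection \<open>Isotropic surfaces of the de Sitter space and their Gauss maps\<close>

definition isotropic_surface :: "complex set \<Rightarrow> (complex \<Rightarrow> real ^ 4) \<Rightarrow> bool" where
  "isotropic_surface M f \<longleftrightarrow>
     smooth_on M f \<and>
     (\<exists>g. homeomorphism M (f ` M) f g) \<and>
     (\<forall>w\<in>M. mink (f w) (f w) = 1 \<and>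
        lightlike (du f w) \<and> future_directed (du f w) \<and>
        lightlike (dv f w) \<and> future_directed (dv f w) \<and>
        du f w \<noteq> dv f w \<and> independent {du f w, dv f w})"

definition gauss_map :: "complex set \<Rightarrow> (complex \<Rightarrow> real ^ 4) \<Rightarrow> (complex \<Rightarrow> real ^ 4) \<Rightarrow> bool" where
  "gauss_map M f \<nu> \<longleftrightarrow>
     smooth_on M \<nu> \<and>
     (\<forall>w\<in>M. mink (\<nu> w) (\<nu> w) = 1 \<and>
        mink (\<nu> w) (f w) = 0 \<and> mink (\<nu> w) (du f w) = 0 \<and> mink (\<nu> w) (dv f w) = 0 \<and>
        positively_oriented (f w) (du f w) (dv f w) (\<nu> w))"

subsection \<open>The representation by \<open>x\<close>, \<open>y\<close>, \<open>\<mu>\<close>\<close>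

definition W :: "complex \<Rightarrow> complex \<Rightarrow> complex ^ 4" where
  "W x y = vector [1 + x * cnj y, x + cnj y, - \<i> * (x - cnj y), - 1 + x * cnj y]"

definition L :: "complex \<Rightarrow> complex ^ 4" where
  "L x = vector [1 + x * cnj x, x + cnj x, - \<i> * (x - cnj x), - 1 + x * cnj x]"

text \<open>Here \<open>W (y w) (x w)\<close> is the componentwise conjugate of \<open>W (x w) (y w)\<close>.\<close>

definition standing_representation ::
  "complex set \<Rightarrow> (complex \<Rightarrow> real ^ 4) \<Rightarrow> (complex \<Rightarrow> real ^ 4) \<Rightarrow>
   (complex \<Rightarrow> real) \<Rightarrow> (complex \<Rightarrow> real) \<Rightarrow>
   (complex \<Rightarrow> complex) \<Rightarrow> (complex \<Rightarrow> complex) \<Rightarrow> (complex \<Rightarrow> complex) \<Rightarrow> bool" where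
  "standing_representation M f \<nu> \<alpha> \<beta> x y \<mu> \<longleftrightarrow>
     smooth_on M \<alpha> \<and> smooth_on M \<beta> \<and> smooth_on M x \<and> smooth_on M y \<and> smooth_on M \<mu> \<and>
     (\<forall>w\<in>M.
        x w \<noteq> y w \<and>
        complexify (du f w) = complex_of_real (\<alpha> w) *s L (x w) \<and>
        complexify (dv f w) = complex_of_real (\<beta> w) *s L (y w) \<and>
        complex_of_real ((cmod (\<mu> w))\<^sup>2) * mink (W (x w) (y w)) (W (y w) (x w)) = 2 \<and>
        complexify (f w) =
          (1 / 2) *s (\<mu> w *s W (x w) (y w) + cnj (\<mu> w) *s W (y w) (x w)) \<and>
        complexify (\<nu> w) =
          (1 / (2 * \<i>)) *s (\<mu> w *s W (x w) (y w) - cnj (\<mu> w) *s W (y w) (x w)))"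

subsection \<open>The class of complex functions and the Cauchy-Riemann type equations\<close>

definition Z_class_with :: "complex set \<Rightarrow> (complex \<Rightarrow> real) \<Rightarrow> (complex \<Rightarrow> complex) \<Rightarrow> bool" where
  "Z_class_with M \<sigma> Z \<longleftrightarrow>
     smooth_on M \<sigma> \<and> (\<forall>w\<in>M. \<sigma> w \<noteq> 0 \<and> dv Z w = \<i> * complex_of_real (\<sigma> w) * du Z w)"

definition cauchy_riemann_type ::
  "complex set \<Rightarrow> (complex \<Rightarrow> real) \<Rightarrow> (complex \<Rightarrow> real) \<Rightarrow> (complex \<Rightarrow> real) \<Rightarrow> bool" where
  "cauchy_riemann_type M \<sigma> \<phi> \<psi> \<longleftrightarrow>
     (\<forall>w\<in>M. du \<phi> w = (1 / \<sigma> w) * dv \<psi> w \<and> dv \<phi> w = - \<sigma> w * du \<psi> w)"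

text \<open>
  Non-constancy of the Gauss map \<open>\<nu>\<close> alone does not give \<open>\<sigma> \<noteq> 0\<close>.  When \<open>\<langle>f\<^sub>u\<^sub>v, \<nu>\<rangle> = 0\<close>, one has
  \<open>\<nu>\<^sub>u = b f\<^sub>v\<close> and \<open>\<nu>\<^sub>v = c f\<^sub>u\<close> for real functions \<open>b\<close>, \<open>c\<close>, and then \<open>x\<^sub>u = i b x\<^sub>v\<close> and
  \<open>y\<^sub>v = - i c y\<^sub>u\<close> where \<open>x\<^sub>v\<close> and \<open>y\<^sub>u\<close> vanish nowhere.  So the equation for \<open>x\<close> holds with
  some \<open>\<sigma>\<close> exactly when \<open>\<nu>\<^sub>u\<close> has no zero, and the one for \<open>y\<close> with some \<open>\<sigma> \<noteq> 0\<close> exactly when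
  \<open>\<nu>\<^sub>v\<close> has no zero.  An example with non-constant \<open>\<nu>\<close> and \<open>\<nu>\<^sub>u = 0\<close>, hence \<open>x\<^sub>u = 0 \<noteq> x\<^sub>v\<close>, near
  any point with \<open>u + v > 0\<close>, is
  \<open>x = exp ((i - 1) v) / (i - 1)\<close>, \<open>\<mu> = exp v (1/2 - 1/(u + v) + i/2)\<close>,
  \<open>y = x + exp (i v) / cnj \<mu>\<close>.
  Therefore \<open>\<nu>\<^sub>u \<noteq> 0\<close> is required for the claim about \<open>x\<close> and \<open>\<nu>\<^sub>v \<noteq> 0\<close> for that about \<open>y\<close>.
\<close>

end

theory Submission
  imports Defs
begin

text \<open>
  The representation says that \<open>f + i \<nu> = \<mu> W(x, y)\<close>.  Put \<open>s = \<mu> cnj (x - y)\<close>, which has no zero by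
  the normalisation of \<open>\<mu>\<close>.  The idea is that the equation \<open>f\<^sub>u = \<alpha> L(x)\<close> and the vanishing of \<open>\<Phi>\<close>
  fix the arguments of \<open>s x\<^sub>u\<close> and \<open>s x\<^sub>v\<close>.

  Differentiating \<open>f = Re (\<mu> W(x, y))\<close> and comparing with \<open>f\<^sub>u = \<alpha> L(x)\<close> gives
  \<open>\<mu> x\<^sub>u + cnj \<mu> y\<^sub>u = (x - y) cnj \<mu>\<^sub>u\<close> and \<open>Re (s x\<^sub>u) = 0\<close> (lemma
  \<open>lightlike_direction_equations\<close>).  Differentiating \<open>f\<^sub>u = \<alpha> L(x)\<close> along \<open>v\<close> gives
  \<open>\<langle>f\<^sub>u\<^sub>v, \<nu>\<rangle> = -2 \<alpha> Im (s x\<^sub>v)\<close> (lemma \<open>mink_lightlike_derivative\<close>), so \<open>\<Phi> = 0\<close> means that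
  \<open>s x\<^sub>v\<close> is real.  Hence \<open>x\<^sub>v / x\<^sub>u\<close> is imaginary, and \<open>\<sigma> = x\<^sub>v / (i x\<^sub>u)\<close> is the required function
  as soon as neither partial derivative vanishes.

  If \<open>x\<^sub>v\<close> vanished, the equations for \<open>f\<^sub>v = \<beta> L(y)\<close> would make \<open>\<mu>\<^sub>v\<close> imaginary, whereas
  \<open>\<beta> = Re \<mu>\<^sub>v\<close> is nonzero (lemma \<open>lightlike_pair_imaginary_ratio\<close>).  If \<open>x\<^sub>u\<close> vanished,
  the condition \<open>\<Phi> = 0\<close> would make \<open>\<mu>\<^sub>u\<close> real, and this forces \<open>\<nu>\<^sub>u = 0\<close> (lemma \<open>gauss_map_stationary\<close>).

  The whole configuration is invariant under exchanging \<open>u \<leftrightarrow> v\<close>, \<open>x \<leftrightarrow> y\<close>, \<open>\<mu> \<leftrightarrow> cnj \<mu>\<close> and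
  \<open>\<nu> \<leftrightarrow> -\<nu>\<close>, so the algebraic lemmas apply verbatim to \<open>y\<close>.  Only the condition
  \<open>\<Phi> = 0\<close> changes under the exchange, from \<open>f\<^sub>u\<^sub>v\<close> to \<open>f\<^sub>v\<^sub>u\<close>; this is where the symmetry of second
  derivatives (lemma \<open>mixed_partials_commute\<close>) enters.  It is needed for the claim about \<open>x\<close> as well, because
  \<open>gauss_map_stationary\<close> uses the condition on \<open>y\<^sub>u\<close>.
\<close>

section \<open>Calculus of smooth functions on an open set\<close>

text \<open>
  Working with the full derivative \<open>D\<close> instead of \<open>du\<close> and \<open>dv\<close> makes the library's derivative rules
  available; the partial derivatives are its values at \<open>1\<close> and \<open>\<i>\<close>.
\<close>

lemma partials_has_derivative:
  assumes "(g has_derivative D) (at w)"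
  shows "((\<lambda>t. g (Complex t (Im w))) has_vector_derivative D 1) (at (Re w))"
    and "((\<lambda>t. g (Complex (Re w) t)) has_vector_derivative D \<i>) (at (Im w))"
    and "du g w = D 1" and "dv g w = D \<i>"
proof -
  have g: "(g has_derivative D) (at (Complex (Re w) (Im w)))" using assms by simp
  have lin: "linear D" using assms has_derivative_linear by blast
  have 1: "((\<lambda>t. Complex t (Im w)) has_derivative (\<lambda>t. of_real t)) (at (Re w))"
    unfolding Complex_eq by (auto intro!: derivative_eq_intros)
  have 2: "((\<lambda>t. Complex (Re w) t) has_derivative (\<lambda>t. \<i> * of_real t)) (at (Im w))"
    unfolding Complex_eq by (auto intro!: derivative_eq_intros)
  show u: "((\<lambda>t. g (Complex t (Im w))) has_vector_derivative D 1) (at (Re w))"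
    using has_derivative_compose[OF 1 g] linear_scale[OF lin, of _ 1]
    by (simp add: has_vector_derivative_def scaleR_conv_of_real)
  show v: "((\<lambda>t. g (Complex (Re w) t)) has_vector_derivative D \<i>) (at (Im w))"
    using has_derivative_compose[OF 2 g] linear_scale[OF lin, of _ \<i>]
    by (simp add: has_vector_derivative_def scaleR_conv_of_real mult.commute)
  show "du g w = D 1" "dv g w = D \<i>"
    unfolding du_def dv_def using u v vector_derivative_at by blast+
qed

lemma partials_cong:
  assumes "open M" "w \<in> M" "\<And>z. z \<in> M \<Longrightarrow> g z = h z" "g differentiable (at w)"
  shows "h differentiable (at w)" "du h w = du g w" "dv h w = dv g w"
proof -
  obtain D where D: "(g has_derivative D) (at w)"
    using assms(4) differentiable_def by blast
  then have "(h has_derivative D) (at w)"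
    using assms by (blast intro: has_derivative_transform_within_open)
  then show "h differentiable (at w)" "du h w = du g w" "dv h w = dv g w"
    using D partials_has_derivative(3,4) differentiable_def by metis+
qed

lemma C_class_cong:
  assumes "open M" "\<And>z. z \<in> M \<Longrightarrow> g z = h z" "C_class k M g"
  shows "C_class k M h"
  using assms(2,3)
proof (induction k arbitrary: g h)
  case 0
  then show ?case using continuous_on_cong[of M M g h] by simp
next
  case (Suc k)
  then have d: "g differentiable (at w)" if "w \<in> M" for w using that by simp
  note p = partials_cong[OF \<open>open M\<close> _ Suc.prems(1) d]
  show ?case using Suc.prems Suc.IH[of "du g" "du h"] Suc.IH[of "dv g" "dv h"] p by auto
qed

lemma C_class_Suc_imp: "C_class (Suc k) M g \<Longrightarrow> C_class k M g"
proof (induction k arbitrary: g)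
  case 0
  then show ?case
    by (auto intro!: continuous_at_imp_continuous_on differentiable_imp_continuous_within)
next
  case (Suc k)
  then show ?case by (metis C_class.simps(2))
qed

lemma C_class_bounded_linear:
  assumes "open M" "bounded_linear T" "C_class k M g"
  shows "C_class k M (\<lambda>z. T (g z))"
  using assms(3)
proof (induction k arbitrary: g)
  case 0
  then show ?case using assms(2) bounded_linear.continuous_on by auto
next
  case (Suc k)
  have d: "(\<lambda>z. T (g z)) differentiable (at w) \<and> T (du g w) = du (\<lambda>z. T (g z)) w
            \<and> T (dv g w) = dv (\<lambda>z. T (g z)) w" if w: "w \<in> M" for w
  proof -
    obtain D where D: "(g has_derivative D) (at w)"
      using Suc.prems w by (auto simp: differentiable_def)
    note TD = bounded_linear.has_derivative[OF assms(2) D]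
    show ?thesis
      using TD partials_has_derivative(3,4)[OF TD] partials_has_derivative(3,4)[OF D]
      by (auto simp: differentiable_def)
  qed
  then show ?case
    using Suc C_class_cong[OF assms(1), of "\<lambda>z. T (du g z)"]
      C_class_cong[OF assms(1), of "\<lambda>z. T (dv g z)"]
    by auto
qed

lemma C_class_add:
  assumes "open M" "C_class k M g" "C_class k M h"
  shows "C_class k M (\<lambda>z. g z + h z)"
  using assms(2,3)
proof (induction k arbitrary: g h)
  case 0
  then show ?case by (auto intro: continuous_on_add)
next
  case (Suc k)
  have d: "(\<lambda>z. g z + h z) differentiable (at w) \<and> du g w + du h w = du (\<lambda>z. g z + h z) w
            \<and> dv g w + dv h w = dv (\<lambda>z. g z + h z) w" if w: "w \<in> M" for w
  proof -
    obtain D where D: "(g has_derivative D) (at w)"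
      using Suc.prems w by (auto simp: differentiable_def)
    obtain E where E: "(h has_derivative E) (at w)"
      using Suc.prems w by (auto simp: differentiable_def)
    note DE = has_derivative_add[OF D E]
    show ?thesis
      using DE partials_has_derivative(3,4)[OF DE] partials_has_derivative(3,4)[OF D]
        partials_has_derivative(3,4)[OF E]
      by (auto simp: differentiable_def)
  qed
  then show ?case
    using Suc C_class_cong[OF assms(1), of "\<lambda>z. du g z + du h z"]
      C_class_cong[OF assms(1), of "\<lambda>z. dv g z + dv h z"]
    by auto
qed

text \<open>
  The Leibniz rule contains the undifferentiated factors, so the induction also needs the inclusion
  of \<open>C\<^sup>k\<^sup>+\<^sup>1\<close> in \<open>C\<^sup>k\<close>.
\<close>

lemma C_class_mult:
  fixes g h :: "complex \<Rightarrow> 'b::real_normed_algebra"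
  assumes "open M" "C_class k M g" "C_class k M h"
  shows "C_class k M (\<lambda>z. g z * h z)"
  using assms(2,3)
proof (induction k arbitrary: g h)
  case 0
  then show ?case by (auto intro: continuous_on_mult)
next
  case (Suc k)
  have d: "(\<lambda>z. g z * h z) differentiable (at w)
      \<and> g w * du h w + du g w * h w = du (\<lambda>z. g z * h z) w
      \<and> g w * dv h w + dv g w * h w = dv (\<lambda>z. g z * h z) w" if w: "w \<in> M" for w
  proof -
    obtain D where D: "(g has_derivative D) (at w)"
      using Suc.prems w by (auto simp: differentiable_def)
    obtain E where E: "(h has_derivative E) (at w)"
      using Suc.prems w by (auto simp: differentiable_def)
    note DE = has_derivative_mult[OF D E]
    show ?thesis
      using DE partials_has_derivative(3,4)[OF DE] partials_has_derivative(3,4)[OF D]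
        partials_has_derivative(3,4)[OF E]
      by (auto simp: differentiable_def)
  qed
  have "C_class k M (\<lambda>z. g z * du h z + du g z * h z)"
       "C_class k M (\<lambda>z. g z * dv h z + dv g z * h z)"
    using Suc.prems C_class_Suc_imp[OF Suc.prems(1)] C_class_Suc_imp[OF Suc.prems(2)]
    by (auto intro!: C_class_add[OF assms(1)] Suc.IH)
  then show ?case
    using d C_class_cong[OF assms(1), of "\<lambda>z. g z * du h z + du g z * h z"]
      C_class_cong[OF assms(1), of "\<lambda>z. g z * dv h z + dv g z * h z"]
    by auto
qed

text \<open>
  The derivative of \<open>1/g\<close> is, up to sign, the product of \<open>g'\<close> and two factors \<open>1/g\<close>, to which the
  induction hypothesis applies.
\<close>

lemma C_class_inverse:
  fixes g :: "complex \<Rightarrow> 'b::real_normed_field"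
  assumes "open M" "\<And>z. z \<in> M \<Longrightarrow> g z \<noteq> 0" "C_class k M g"
  shows "C_class k M (\<lambda>z. inverse (g z))"
  using assms(3)
proof (induction k)
  case 0
  then show ?case using assms(2) by (auto intro: continuous_on_inverse)
next
  case (Suc k)
  have d: "(\<lambda>z. inverse (g z)) differentiable (at w)
      \<and> - (inverse (g w) * du g w * inverse (g w)) = du (\<lambda>z. inverse (g z)) w
      \<and> - (inverse (g w) * dv g w * inverse (g w)) = dv (\<lambda>z. inverse (g z)) w" if w: "w \<in> M" for w
  proof -
    obtain D where D: "(g has_derivative D) (at w)"
      using Suc.prems w by (auto simp: differentiable_def)
    note DI = Deriv.has_derivative_inverse[OF assms(2)[OF w] D]
    show ?thesis
      using DI partials_has_derivative(3,4)[OF DI] partials_has_derivative(3,4)[OF D]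
      by (auto simp: differentiable_def)
  qed
  note inv = Suc.IH[OF C_class_Suc_imp[OF Suc.prems]]
  have "C_class k M (\<lambda>z. - (inverse (g z) * du g z * inverse (g z)))"
       "C_class k M (\<lambda>z. - (inverse (g z) * dv g z * inverse (g z)))"
    using Suc.prems inv
    by (auto intro!: C_class_mult[OF assms(1)]
        C_class_bounded_linear[OF assms(1) bounded_linear_minus[OF bounded_linear_ident]])
  then show ?case
    using d C_class_cong[OF assms(1), of "\<lambda>z. - (inverse (g z) * du g z * inverse (g z))"]
      C_class_cong[OF assms(1), of "\<lambda>z. - (inverse (g z) * dv g z * inverse (g z))"]
    by auto
qed

lemma smooth_on_partials:
  assumes "smooth_on M g"
  shows "smooth_on M (du g)" "smooth_on M (dv g)"
  using assms C_class.simps(2) unfolding smooth_on_def by blast+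

lemma smooth_on_imp_differentiable:
  assumes "smooth_on M g" "w \<in> M"
  shows "g differentiable (at w)"
  using assms C_class.simps(2)[of 0 M g] unfolding smooth_on_def by blast

lemma smooth_on_imp_continuous_on: "smooth_on M g \<Longrightarrow> continuous_on M g"
  unfolding smooth_on_def using C_class.simps(1) by blast

text \<open>
  Two applications of the mean value theorem.  The left-hand side is symmetric in the two variables,
  so applying this to \<open>G\<close> and to \<open>G\<close> with exchanged arguments compares the two mixed derivatives at
  nearby points.
\<close>

lemma rectangle_mixed_difference:
  fixes G :: "real \<Rightarrow> real \<Rightarrow> real"
  assumes "h > 0"
    and G1: "\<And>s t. s \<in> {p..p+h} \<Longrightarrow> t \<in> {q..q+h} \<Longrightarrow>
               ((\<lambda>s. G s t) has_real_derivative G1 s t) (at s)"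
    and G12: "\<And>s t. s \<in> {p..p+h} \<Longrightarrow> t \<in> {q..q+h} \<Longrightarrow>
               (G1 s has_real_derivative G12 s t) (at t)"
  obtains s t where "s \<in> {p..p+h}" "t \<in> {q..q+h}"
    "G (p+h) (q+h) - G (p+h) q - G p (q+h) + G p q = h * h * G12 s t"
proof -
  have "\<exists>s>p. s < p+h \<and> (\<lambda>s. G s (q+h) - G s q) (p+h) - (\<lambda>s. G s (q+h) - G s q) p
          = (p+h-p) * (G1 s (q+h) - G1 s q)"
    by (rule MVT2) (use \<open>h > 0\<close> in \<open>auto intro!: derivative_intros G1\<close>)
  then obtain s where "p < s" "s < p + h"
    "G (p+h) (q+h) - G (p+h) q - (G p (q+h) - G p q) = h * (G1 s (q+h) - G1 s q)"
    by auto
  then have s: "s \<in> {p..p+h}"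
    "G (p+h) (q+h) - G (p+h) q - G p (q+h) + G p q = h * (G1 s (q+h) - G1 s q)"
    by auto
  have "\<exists>t>q. t < q+h \<and> G1 s (q+h) - G1 s q = (q+h-q) * G12 s t"
    by (rule MVT2) (use \<open>h > 0\<close> s(1) in \<open>auto intro!: G12\<close>)
  then obtain t where t: "q < t" "t < q + h" "G1 s (q+h) - G1 s q = h * G12 s t"
    by auto
  with s show ?thesis by (intro that[of s t]) auto
qed

lemma mixed_partials_commute_real:
  fixes g :: "complex \<Rightarrow> real"
  assumes "open M" "smooth_on M g" "w \<in> M"
  shows "dv (du g) w = du (dv g) w"
proof (rule ccontr)
  assume ne: "dv (du g) w \<noteq> du (dv g) w"
  define e where "e = \<bar>dv (du g) w - du (dv g) w\<bar> / 2"
  have "e > 0" using ne by (simp add: e_def)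
  note sm = smooth_on_partials[OF assms(2)]
  have cont: "continuous_on M (dv (du g))" "continuous_on M (du (dv g))"
    using sm smooth_on_partials smooth_on_imp_continuous_on by blast+
  then have "isCont (dv (du g)) w" "isCont (du (dv g)) w"
    using assms continuous_on_eq_continuous_at by blast+
  then obtain d1 d2 where d: "d1 > 0" "d2 > 0"
      "\<And>z. dist z w < d1 \<Longrightarrow> dist (dv (du g) z) (dv (du g) w) < e"
      "\<And>z. dist z w < d2 \<Longrightarrow> dist (du (dv g) z) (du (dv g) w) < e"
    using \<open>e > 0\<close> unfolding continuous_at_eps_delta by metis
  obtain d3 where d3: "d3 > 0" "ball w d3 \<subseteq> M"
    using assms openE by blast
  \<comment> \<open>A point of the square with lower left corner \<open>w\<close> and side \<open>h\<close> is within \<open>2 h\<close> of \<open>w\<close>.\<close>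
  define h where "h = min d1 (min d2 d3) / 3"
  have h: "h > 0" "2 * h < d1" "2 * h < d2" "2 * h < d3"
    using d(1,2) d3(1) by (auto simp: h_def min_def)
  define p q where "p = Re w" and "q = Im w"
  have near: "dist (Complex s t) w \<le> 2 * h" if "s \<in> {p..p+h}" "t \<in> {q..q+h}" for s t
  proof -
    have "dist (Complex s t) w \<le> \<bar>s - p\<bar> + \<bar>t - q\<bar>"
      unfolding dist_norm using cmod_le[of "Complex s t - w"] by (simp add: p_def q_def)
    also have "\<dots> \<le> 2 * h" using that by auto
    finally show ?thesis .
  qed
  have inM: "Complex s t \<in> M" if "s \<in> {p..p+h}" "t \<in> {q..q+h}" for s t
    using near[OF that] h d3(2) by (auto simp: dist_commute)
  have partial: "((\<lambda>s. k (Complex s t)) has_real_derivative du k (Complex s t)) (at s)"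
      "((\<lambda>t. k (Complex s t)) has_real_derivative dv k (Complex s t)) (at t)"
    if k: "smooth_on M k" and st: "s \<in> {p..p+h}" "t \<in> {q..q+h}" for k :: "complex \<Rightarrow> real" and s t
  proof -
    obtain D where "(k has_derivative D) (at (Complex s t))"
      using smooth_on_imp_differentiable[OF k inM[OF st]]
      by (auto simp: differentiable_def)
    from partials_has_derivative[OF this]
    show "((\<lambda>s. k (Complex s t)) has_real_derivative du k (Complex s t)) (at s)"
      "((\<lambda>t. k (Complex s t)) has_real_derivative dv k (Complex s t)) (at t)"
      by (simp_all add: has_real_derivative_iff_has_vector_derivative)
  qed
  obtain s t where st: "s \<in> {p..p+h}" "t \<in> {q..q+h}"
    "g (Complex (p+h) (q+h)) - g (Complex (p+h) q) - g (Complex p (q+h)) + g (Complex p q)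
      = h * h * dv (du g) (Complex s t)"
    by (rule rectangle_mixed_difference[of h p q "\<lambda>s t. g (Complex s t)"
          "\<lambda>s t. du g (Complex s t)" "\<lambda>s t. dv (du g) (Complex s t)"])
       (use h(1) partial assms(2) sm in auto)
  obtain t' s' where st': "t' \<in> {q..q+h}" "s' \<in> {p..p+h}"
    "g (Complex (p+h) (q+h)) - g (Complex p (q+h)) - g (Complex (p+h) q) + g (Complex p q)
      = h * h * du (dv g) (Complex s' t')"
    by (rule rectangle_mixed_difference[of h q p "\<lambda>t s. g (Complex s t)"
          "\<lambda>t s. dv g (Complex s t)" "\<lambda>t s. du (dv g) (Complex s t)"])
       (use h(1) partial assms(2) sm in auto)
  have "h * h * dv (du g) (Complex s t) = h * h * du (dv g) (Complex s' t')"
    using st(3) st'(3) by linarith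
  then have "dv (du g) (Complex s t) = du (dv g) (Complex s' t')"
    using h(1) by simp
  moreover have "dist (dv (du g) (Complex s t)) (dv (du g) w) < e"
    using d(3) near[OF st(1,2)] h by force
  moreover have "dist (du (dv g) (Complex s' t')) (du (dv g) w) < e"
    using d(4) near[OF st'(2,1)] h by force
  ultimately show False unfolding e_def dist_real_def by (simp add: abs_if split: if_splits)
qed

text \<open>
  Pairing with the difference \<open>z\<close> of the two mixed derivatives reduces this to a real-valued function
  and yields \<open>z \<bullet> z = 0\<close>.
\<close>

lemma mixed_partials_commute:
  fixes g :: "complex \<Rightarrow> 'b::real_inner"
  assumes "open M" "smooth_on M g" "w \<in> M"
  shows "dv (du g) w = du (dv g) w"
proof -
  define z where "z = dv (du g) w - du (dv g) w"
  define T where "T = (\<lambda>b::'b. z \<bullet> b)"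
  have T: "bounded_linear T" unfolding T_def by (rule bounded_linear_inner_right)
  have TD: "du (\<lambda>u. T (k u)) c = T (du k c) \<and> dv (\<lambda>u. T (k u)) c = T (dv k c)
      \<and> (\<lambda>u. T (k u)) differentiable (at c)"
    if sk: "smooth_on M k" and c: "c \<in> M" for k c
  proof -
    obtain D where D: "(k has_derivative D) (at c)"
      using smooth_on_imp_differentiable[OF sk c] by (auto simp: differentiable_def)
    note TD = bounded_linear.has_derivative[OF T D]
    show ?thesis
      using TD partials_has_derivative(3,4)[OF TD] partials_has_derivative(3,4)[OF D]
      by (auto simp: differentiable_def)
  qed
  note sm = smooth_on_partials[OF assms(2)]
  have "smooth_on M (\<lambda>u. T (g u))"
    using assms C_class_bounded_linear[OF assms(1) T] by (auto simp: smooth_on_def)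
  from mixed_partials_commute_real[OF assms(1) this assms(3)]
  have "dv (du (\<lambda>u. T (g u))) w = du (dv (\<lambda>u. T (g u))) w" .
  moreover have "dv (du (\<lambda>u. T (g u))) w = T (dv (du g) w)"
    using partials_cong(3)[OF assms(1,3), of "\<lambda>c. T (du g c)" "du (\<lambda>u. T (g u))"]
      TD[OF assms(2)] TD[OF sm(1) assms(3)] by simp
  moreover have "du (dv (\<lambda>u. T (g u))) w = T (du (dv g) w)"
    using partials_cong(2)[OF assms(1,3), of "\<lambda>c. T (dv g c)" "dv (\<lambda>u. T (g u))"]
      TD[OF assms(2)] TD[OF sm(2) assms(3)] by simp
  ultimately have "z \<bullet> z = 0" by (simp add: T_def z_def inner_diff_right)
  then show ?thesis by (simp add: z_def)
qed

section \<open>Null coordinates of Minkowski space\<close>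

text \<open>
  These are the entries of the Hermitian matrix that corresponds to \<open>p\<close>, the first two on its
  diagonal.  Extended complex linearly, they take the monomial values \<open>2 x (cnj y)\<close>, \<open>2\<close> and \<open>2 x\<close> at
  \<open>W x y\<close>, which keeps the derivatives of the representation short.
\<close>

definition null_sum :: "real ^ 4 \<Rightarrow> real" where "null_sum p = p $ 1 + p $ 4"
definition null_diff :: "real ^ 4 \<Rightarrow> real" where "null_diff p = p $ 1 - p $ 4"
definition transverse :: "real ^ 4 \<Rightarrow> complex" where "transverse p = Complex (p $ 2) (p $ 3)"

lemma null_coords_bounded_linear:
  "bounded_linear null_sum" "bounded_linear null_diff" "bounded_linear transverse"
  unfolding null_sum_def null_diff_def transverse_def Complex_eq
  by (auto intro!: bounded_linear_add bounded_linear_sub bounded_linear_vec_nth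
      bounded_linear_const_mult bounded_linear_compose[OF bounded_linear_of_real])

lemma null_coords_eq_0:
  assumes "null_sum p = 0" "null_diff p = 0" "transverse p = 0"
  shows "p = 0"
proof -
  have "p $ 1 = 0" "p $ 2 = 0" "p $ 3 = 0" "p $ 4 = 0"
    using assms unfolding null_sum_def null_diff_def transverse_def by (auto simp: complex_eq_iff)
  then show ?thesis by (simp add: vec_eq_iff forall_4)
qed

lemma mink_null_coords:
  "mink p q = Re (transverse p * cnj (transverse q))
     - (null_sum p * null_diff q + null_diff p * null_sum q) / 2"
  by (simp add: mink_def null_sum_def null_diff_def transverse_def field_simps)

lemma L_eq_W: "L x = W x x"
  by (simp add: L_def W_def)

lemma vector_4:
  "(vector [a, b, c, d] :: 'a::zero ^ 4) $ 1 = a" "(vector [a, b, c, d] :: 'a ^ 4) $ 2 = b"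
  "(vector [a, b, c, d] :: 'a ^ 4) $ 3 = c" "(vector [a, b, c, d] :: 'a ^ 4) $ 4 = d"
  unfolding vector_def by simp_all

text \<open>
  This form covers all vector fields of the representation: \<open>f\<close> with \<open>n = cnj m\<close>, \<open>\<nu>\<close> with
  \<open>n = - cnj m\<close>, and \<open>f\<^sub>u\<close>, \<open>f\<^sub>v\<close> with \<open>x = y\<close> and \<open>n = 0\<close>.
\<close>

lemma null_coords_W_combination:
  assumes "complexify p = c *s (m *s W x y + n *s W y x)"
  shows "of_real (null_diff p) = 2 * c * (m + n)"
    and "transverse p = 2 * c * (m * x + n * y)"
    and "of_real (null_sum p) = 2 * c * (m * x * cnj y + n * y * cnj x)"
proof -
  have c: "of_real (p $ i) = (c *s (m *s W x y + n *s W y x)) $ i" for i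
    using arg_cong[OF assms, of "\<lambda>q. q $ i"] by (simp add: complexify_def)
  have t: "transverse p = of_real (p $ 2) + \<i> * of_real (p $ 3)"
    by (simp add: transverse_def Complex_eq)
  show "of_real (null_diff p) = 2 * c * (m + n)"
    and "transverse p = 2 * c * (m * x + n * y)"
    and "of_real (null_sum p) = 2 * c * (m * x * cnj y + n * y * cnj x)"
    unfolding t null_diff_def null_sum_def of_real_add of_real_diff c
    by (simp_all add: W_def vector_4 algebra_simps)
qed

lemma null_coords_W_derivative:
  fixes w :: "'a::real_normed_vector"
  assumes "open M" "w \<in> M"
    and rep: "\<And>z. z \<in> M \<Longrightarrow>
        complexify (g z) = c *s (m z *s W (x z) (y z) + n z *s W (y z) (x z))"
    and g: "(g has_derivative G) (at w)"
    and m: "(m has_derivative M') (at w)"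
    and n: "(n has_derivative N') (at w)"
    and x: "(x has_derivative X) (at w)"
    and y: "(y has_derivative Y) (at w)"
  shows "of_real (null_diff (G e)) = 2 * c * (M' e + N' e)"
    and "transverse (G e) = 2 * c * (M' e * x w + m w * X e + (N' e * y w + n w * Y e))"
    and "of_real (null_sum (G e))
      = 2 * c * (M' e * x w * cnj (y w) + m w * X e * cnj (y w) + m w * x w * cnj (Y e)
           + (N' e * y w * cnj (x w) + n w * Y e * cnj (x w) + n w * y w * cnj (X e)))"
proof -
  note R = null_coords_W_combination[OF rep]
  have uniq: "P e = Q e" if "(k has_derivative P) (at w)" "(l has_derivative Q) (at w)"
      "\<And>z. z \<in> M \<Longrightarrow> k z = l z" for k l P Q :: "'a \<Rightarrow> complex"
    using has_derivative_transform_within_open[OF that(1) assms(1,2) that(3)] that(2)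
      has_derivative_unique by blast
  have "((\<lambda>z. of_real (null_diff (g z))) has_derivative (\<lambda>e. complex_of_real (null_diff (G e)))) (at w)"
    by (intro has_derivative_of_real bounded_linear.has_derivative[OF null_coords_bounded_linear(2) g])
  moreover have "((\<lambda>z. 2 * c * (m z + n z)) has_derivative (\<lambda>e. 2 * c * (M' e + N' e))) (at w)"
    by (auto intro!: derivative_eq_intros m n)
  ultimately show "of_real (null_diff (G e)) = 2 * c * (M' e + N' e)"
    by (rule uniq[OF _ _ R(1)])
  have "((\<lambda>z. transverse (g z)) has_derivative (\<lambda>e. transverse (G e))) (at w)"
    by (intro bounded_linear.has_derivative[OF null_coords_bounded_linear(3) g])
  moreover have "((\<lambda>z. 2 * c * (m z * x z + n z * y z)) has_derivative
      (\<lambda>e. 2 * c * (M' e * x w + m w * X e + (N' e * y w + n w * Y e)))) (at w)"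
    by (auto intro!: derivative_eq_intros m n x y simp: algebra_simps)
  ultimately show "transverse (G e) = 2 * c * (M' e * x w + m w * X e + (N' e * y w + n w * Y e))"
    by (rule uniq[OF _ _ R(2)])
  have "((\<lambda>z. of_real (null_sum (g z))) has_derivative (\<lambda>e. complex_of_real (null_sum (G e)))) (at w)"
    by (intro has_derivative_of_real bounded_linear.has_derivative[OF null_coords_bounded_linear(1) g])
  moreover have "((\<lambda>z. 2 * c * (m z * x z * cnj (y z) + n z * y z * cnj (x z))) has_derivative
      (\<lambda>e. 2 * c * (M' e * x w * cnj (y w) + m w * X e * cnj (y w) + m w * x w * cnj (Y e)
           + (N' e * y w * cnj (x w) + n w * Y e * cnj (x w) + n w * y w * cnj (X e))))) (at w)"
    by (auto intro!: derivative_eq_intros m n has_derivative_cnj x y simp: algebra_simps)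
  ultimately show "of_real (null_sum (G e))
      = 2 * c * (M' e * x w * cnj (y w) + m w * X e * cnj (y w) + m w * x w * cnj (Y e)
           + (N' e * y w * cnj (x w) + n w * Y e * cnj (x w) + n w * y w * cnj (X e)))"
    by (rule uniq[OF _ _ R(3)])
qed

section \<open>Algebra of the first derivatives\<close>

text \<open>
  The hypotheses say that the derivative of \<open>Re (m W(x, y))\<close> in some direction is \<open>a L(x)\<close>.
  Eliminating \<open>a\<close> between the first two gives the first conclusion; inserting that and its conjugate
  into the third leaves only the real part in the second conclusion.
\<close>

lemma lightlike_direction_equations:
  fixes x y m x1 y1 m1 :: complex and a :: real
  assumes null_diff: "m1 + cnj m1 = 2 * a"
    and transverse: "m1 * x + m * x1 + (cnj m1 * y + cnj m * y1) = 2 * a * x"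
    and null_sum: "m1 * x * cnj y + m * x1 * cnj y + m * x * cnj y1
         + (cnj m1 * y * cnj x + cnj m * y1 * cnj x + cnj m * y * cnj x1) = 2 * a * (x * cnj x)"
  shows "m * x1 + cnj m * y1 = (x - y) * cnj m1"
    and "Re (m * x1 * cnj (x - y)) = 0"
proof -
  show A: "m * x1 + cnj m * y1 = (x - y) * cnj m1"
    using transverse unfolding null_diff[symmetric] by (simp add: algebra_simps)
  have B: "cnj m * cnj x1 + m * cnj y1 = cnj (x - y) * m1"
    using arg_cong[OF A, of cnj] by simp
  have "m * x1 * cnj (x - y) + cnj (m * x1 * cnj (x - y))
      = x * (cnj m * cnj x1 + m * cnj y1 - cnj (x - y) * m1)
      + cnj x * (m * x1 + cnj m * y1 - (x - y) * cnj m1)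
      - (m1 * x * cnj y + m * x1 * cnj y + m * x * cnj y1
         + (cnj m1 * y * cnj x + cnj m * y1 * cnj x + cnj m * y * cnj x1)
         - (m1 + cnj m1) * (x * cnj x))"
    by (simp add: algebra_simps)
  also have "\<dots> = 0" using A B null_sum null_diff by simp
  finally have "2 * Re (m * x1 * cnj (x - y)) = 0"
    unfolding complex_add_cnj of_real_eq_0_iff .
  then show "Re (m * x1 * cnj (x - y)) = 0" by linarith
qed

text \<open>
  Here \<open>p\<close> is the derivative of \<open>a L(x)\<close> and \<open>q\<close> is \<open>\<nu>\<close>.  The part of \<open>p\<close> proportional to \<open>L(x)\<close> is
  orthogonal to \<open>\<nu>\<close>, so the derivative of \<open>a\<close> drops out.  The sign \<open>s = \<plusminus>1\<close> accommodates the exchange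
  of \<open>x\<close> and \<open>y\<close>, which maps \<open>\<nu>\<close> to \<open>- \<nu>\<close>.
\<close>

lemma mink_lightlike_derivative:
  fixes x y m X :: complex and a a' s :: real
  assumes p: "of_real (null_diff p) = (2 * a' :: complex)" "transverse p = 2 * (a' * x + a * X)"
      "of_real (null_sum p) = 2 * (a' * x * cnj x + a * X * cnj x + a * x * cnj X)"
    and q: "of_real (null_diff q) = - s * \<i> * (m - cnj m)" "transverse q = - s * \<i> * (m * x - cnj m * y)"
      "of_real (null_sum q) = - s * \<i> * (m * x * cnj y - cnj m * y * cnj x)"
  shows "mink p q = - 2 * s * a * Im (m * X * cnj (x - y))"
proof -
  have "null_diff p = 2 * a'" "null_sum p = Re (2 * (a' * x * cnj x + a * X * cnj x + a * x * cnj X))"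
    "null_diff q = Re (- s * \<i> * (m - cnj m))" "null_sum q = Re (- s * \<i> * (m * x * cnj y - cnj m * y * cnj x))"
    using p(1,3)[THEN arg_cong[of _ _ Re]] q(1,3)[THEN arg_cong[of _ _ Re]] by simp_all
  note coords = this
  show ?thesis
    unfolding mink_null_coords p(2) q(2) coords
    by (simp add: algebra_simps add_divide_distrib diff_divide_distrib)
qed

text \<open>
  The indices \<open>1\<close> and \<open>2\<close> are the directions in which \<open>f\<close> moves along \<open>L(x)\<close> and \<open>L(y)\<close>.
  Multiplying both \<open>x1\<close> and \<open>x2\<close> by \<open>m cnj (x - y)\<close> makes one imaginary and the other real.  If \<open>x2\<close>
  vanished, \<open>e2\<close> would give \<open>Re m2 = 0\<close>, contrary to \<open>b \<noteq> 0\<close>.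
\<close>

lemma lightlike_pair_imaginary_ratio:
  fixes x y m x1 x2 y2 m2 :: complex and b :: real
  assumes xy: "x \<noteq> y" and m: "m \<noteq> 0" and b: "b \<noteq> 0" "m2 + cnj m2 = 2 * b"
    and e1: "Re (m * x1 * cnj (x - y)) = 0"
    and e2: "cnj m * y2 + m * x2 = (y - x) * m2" "Re (cnj m * y2 * cnj (y - x)) = 0"
    and mixed: "Im (m * x2 * cnj (x - y)) = 0"
  shows "x2 \<noteq> 0" and "Re (x2 / x1) = 0"
proof -
  have pos: "(cmod (x - y))\<^sup>2 > 0" using xy by simp
  show "x2 \<noteq> 0"
  proof
    assume "x2 = 0"
    then have y2: "cnj m * y2 = (y - x) * m2" using e2(1) by simp
    have "cnj m * y2 * cnj (y - x) = ((x - y) * cnj (x - y)) * m2"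
      unfolding y2 by (simp add: algebra_simps)
    then have "Re m2 = 0"
      using e2(2) pos unfolding complex_norm_square[symmetric] by simp
    then show False using b by (simp add: complex_eq_iff)
  qed
  show "Re (x2 / x1) = 0"
  proof (cases "x1 = 0")
    case False
    have "x2 / x1 = (m * x2 * cnj (x - y)) / (m * x1 * cnj (x - y))"
      using m xy by simp
    also have "Re \<dots> = 0"
      unfolding Re_divide using mixed e1 by simp
    finally show ?thesis .
  qed simp
qed

text \<open>
  Up to the sign \<open>s\<close>, \<open>q\<close> is the derivative of \<open>\<nu>\<close> in the direction in which \<open>f\<close> moves along \<open>L(x)\<close>.  With \<open>x1 = 0\<close>,
  \<open>e1\<close> and \<open>mixed\<close> make \<open>m1\<close> real, and then the derivative of \<open>m W(x, y)\<close> is the real vector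
  \<open>m1 L(x)\<close>, so that the imaginary part \<open>\<nu>\<close> of \<open>m W(x, y)\<close> has derivative zero.
\<close>

lemma gauss_map_stationary:
  fixes x y m x1 y1 m1 :: complex and s :: real
  assumes "x \<noteq> y"
    and e1: "m * x1 + cnj m * y1 = (x - y) * cnj m1"
    and mixed: "Im (cnj m * y1 * cnj (y - x)) = 0"
    and q: "of_real (null_diff q) = - s * \<i> * (m1 - cnj m1)"
      "transverse q = - s * \<i> * (m1 * x + m * x1 - (cnj m1 * y + cnj m * y1))"
      "of_real (null_sum q) = - s * \<i> * (m1 * x * cnj y + m * x1 * cnj y + m * x * cnj y1
         - (cnj m1 * y * cnj x + cnj m * y1 * cnj x + cnj m * y * cnj x1))"
    and x1: "x1 = 0"
  shows "q = 0"
proof -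
  have pos: "(cmod (x - y))\<^sup>2 > 0" using \<open>x \<noteq> y\<close> by simp
  have y1: "cnj m * y1 = (x - y) * cnj m1" using e1 x1 by simp
  have "cnj m * y1 * cnj (y - x) = - ((x - y) * cnj (x - y)) * cnj m1"
    unfolding y1 by (simp add: algebra_simps)
  then have "Im m1 = 0"
    using mixed pos unfolding complex_norm_square[symmetric] by simp
  then have r: "cnj m1 = m1" by (simp add: complex_eq_iff)
  have y1: "cnj m * y1 = (x - y) * m1" using y1 r by simp
  have "m * x * cnj y1 = x * cnj (cnj m * y1)" by simp
  also have "\<dots> = x * (cnj (x - y) * m1)"
    unfolding y1 by (simp add: r)
  finally have y1': "m * x * cnj y1 = x * (cnj (x - y) * m1)" .
  show "q = 0"
  proof (rule null_coords_eq_0)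
    have "complex_of_real (null_diff q) = 0" unfolding q r by simp
    then show "null_diff q = 0" by simp
    have "complex_of_real (null_sum q) = 0"
      unfolding q y1 r y1' x1 by (simp add: algebra_simps)
    then show "null_sum q = 0" by simp
    show "transverse q = 0" unfolding q y1 r x1 by (simp add: algebra_simps)
  qed
qed

section \<open>The Cauchy-Riemann type equations\<close>

lemma imaginary_ratio_imp_Z_class:
  assumes "open M" "smooth_on M Z"
    and nz: "\<And>w. w \<in> M \<Longrightarrow> du Z w \<noteq> 0" "\<And>w. w \<in> M \<Longrightarrow> dv Z w \<noteq> 0"
    and im: "\<And>w. w \<in> M \<Longrightarrow> Re (dv Z w / du Z w) = 0"
  shows "\<exists>\<sigma>. Z_class_with M \<sigma> Z \<and>
            cauchy_riemann_type M \<sigma> (\<lambda>w. Re (Z w)) (\<lambda>w. Im (Z w))"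
proof (intro exI conjI)
  define \<sigma> where "\<sigma> = (\<lambda>w. Im (dv Z w * inverse (du Z w)))"
  have \<sigma>: "dv Z w / du Z w = \<i> * \<sigma> w" if "w \<in> M" for w
  proof -
    have "c = \<i> * Im c" if "Re c = 0" for c using that by (simp add: complex_eq_iff)
    from this[OF im[OF that]] show ?thesis by (simp only: \<sigma>_def divide_inverse)
  qed
  have eq: "dv Z w = \<i> * \<sigma> w * du Z w" if "w \<in> M" for w
    using \<sigma>[OF that] nz(1)[OF that] by (simp add: divide_eq_eq)
  have ne: "\<sigma> w \<noteq> 0" if "w \<in> M" for w
    using eq[OF that] nz(2)[OF that] by auto
  have "C_class k M (\<lambda>w. dv Z w * inverse (du Z w))" for k
    using smooth_on_partials[OF assms(2)] nz(1) unfolding smooth_on_def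
    by (intro C_class_mult[OF \<open>open M\<close>] C_class_inverse[OF \<open>open M\<close>]) blast+
  then have "smooth_on M \<sigma>"
    unfolding smooth_on_def \<sigma>_def
    by (intro allI C_class_bounded_linear[OF \<open>open M\<close> bounded_linear_Im])
  with eq ne show "Z_class_with M \<sigma> Z" by (auto simp: Z_class_with_def)
  have "du (\<lambda>w. Re (Z w)) w = 1 / \<sigma> w * dv (\<lambda>w. Im (Z w)) w \<and>
        dv (\<lambda>w. Re (Z w)) w = - \<sigma> w * du (\<lambda>w. Im (Z w)) w" if w: "w \<in> M" for w
  proof -
    obtain D where D: "(Z has_derivative D) (at w)"
      using smooth_on_imp_differentiable[OF assms(2) w] by (auto simp: differentiable_def)
    note p = partials_has_derivative(3,4)[OF D]
      partials_has_derivative(3,4)[OF has_derivative_Re[OF D]]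
      partials_has_derivative(3,4)[OF has_derivative_Im[OF D]]
    show ?thesis
      using eq[OF w] ne[OF w] unfolding p by simp
  qed
  then show "cauchy_riemann_type M \<sigma> (\<lambda>w. Re (Z w)) (\<lambda>w. Im (Z w))"
    by (simp add: cauchy_riemann_type_def)
qed

text \<open>
  The real part of \<open>du y w / dv y w\<close> appears in place of that of its inverse because the exchange
  of \<open>u\<close> and \<open>v\<close> turns the quotient for \<open>x\<close> upside down.
\<close>

lemma zero_mean_curvature_partials:
  assumes "open M" and iso: "isotropic_surface M f" and "smooth_on M \<nu>"
    and rep: "standing_representation M f \<nu> \<alpha> \<beta> x y \<mu>"
    and mixed: "\<forall>w\<in>M. mink (dv (du f) w) (\<nu> w) = 0"
    and w: "w \<in> M"
  shows "dv x w \<noteq> 0" "Re (dv x w / du x w) = 0" "du \<nu> w \<noteq> 0 \<Longrightarrow> du x w \<noteq> 0"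
    and "du y w \<noteq> 0" "Re (du y w / dv y w) = 0" "dv \<nu> w \<noteq> 0 \<Longrightarrow> dv y w \<noteq> 0"
proof -
  have f: "smooth_on M f" using iso by (simp add: isotropic_surface_def)
  have ll: "du f w \<noteq> 0" "dv f w \<noteq> 0"
    using iso w by (auto simp: isotropic_surface_def lightlike_def)
  have sm: "smooth_on M \<alpha>" "smooth_on M \<beta>" "smooth_on M x" "smooth_on M y" "smooth_on M \<mu>"
    and xy: "x w \<noteq> y w"
    and norm: "of_real ((cmod (\<mu> w))\<^sup>2) * mink (W (x w) (y w)) (W (y w) (x w)) = 2"
    using rep w by (auto simp: standing_representation_def)
  have rf: "complexify (f z) = (1/2) *s (\<mu> z *s W (x z) (y z) + cnj (\<mu> z) *s W (y z) (x z))"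
    and r\<nu>: "complexify (\<nu> z) =
      (1/(2*\<i>)) *s (\<mu> z *s W (x z) (y z) + (- cnj (\<mu> z)) *s W (y z) (x z))"
    and ru: "complexify (du f z) = 1 *s (of_real (\<alpha> z) *s W (x z) (x z) + 0 *s W (x z) (x z))"
    and rv: "complexify (dv f z) = 1 *s (of_real (\<beta> z) *s W (y z) (y z) + 0 *s W (y z) (y z))"
    if "z \<in> M" for z
    using rep that unfolding standing_representation_def L_eq_W
    by (auto simp: vec_eq_iff)
  have mu: "\<mu> w \<noteq> 0" using norm by auto
  obtain F where F: "(f has_derivative F) (at w)"
    using smooth_on_imp_differentiable[OF f w] by (auto simp: differentiable_def)
  obtain N where N: "(\<nu> has_derivative N) (at w)"
    using smooth_on_imp_differentiable[OF assms(3) w] by (auto simp: differentiable_def)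
  obtain A where A: "(\<alpha> has_derivative A) (at w)"
    using smooth_on_imp_differentiable[OF sm(1) w] by (auto simp: differentiable_def)
  obtain B where B: "(\<beta> has_derivative B) (at w)"
    using smooth_on_imp_differentiable[OF sm(2) w] by (auto simp: differentiable_def)
  obtain X where X: "(x has_derivative X) (at w)"
    using smooth_on_imp_differentiable[OF sm(3) w] by (auto simp: differentiable_def)
  obtain Y where Y: "(y has_derivative Y) (at w)"
    using smooth_on_imp_differentiable[OF sm(4) w] by (auto simp: differentiable_def)
  obtain K where K: "(\<mu> has_derivative K) (at w)"
    using smooth_on_imp_differentiable[OF sm(5) w] by (auto simp: differentiable_def)
  obtain G where G: "(du f has_derivative G) (at w)"
    using smooth_on_imp_differentiable[OF smooth_on_partials(1)[OF f] w]
    by (auto simp: differentiable_def)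
  obtain H where H: "(dv f has_derivative H) (at w)"
    using smooth_on_imp_differentiable[OF smooth_on_partials(2)[OF f] w]
    by (auto simp: differentiable_def)
  note p = partials_has_derivative(3,4)
  note Kc = has_derivative_cnj[OF K]
  \<comment> \<open>The partial derivatives of \<open>f\<close> are lightlike, in particular nonzero.\<close>
  have alpha: "\<alpha> w \<noteq> 0" and beta: "\<beta> w \<noteq> 0"
    using ll ru[OF w] rv[OF w] by (auto simp: vec_eq_iff complexify_def)
  note dF = null_coords_W_derivative[OF \<open>open M\<close> w rf F K Kc X Y]
  note dN = null_coords_W_derivative[OF \<open>open M\<close> w r\<nu> N K has_derivative_minus[OF Kc] X Y]
  note dG = null_coords_W_derivative[OF \<open>open M\<close> w ru G
      has_derivative_of_real[OF A] has_derivative_const X X]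
  note dH = null_coords_W_derivative[OF \<open>open M\<close> w rv H
      has_derivative_of_real[OF B] has_derivative_const Y Y]
  note cu = null_coords_W_combination[OF ru[OF w], unfolded p(1)[OF F]]
  note cv = null_coords_W_combination[OF rv[OF w], unfolded p(2)[OF F]]
  note c\<nu> = null_coords_W_combination[OF r\<nu>[OF w]]
  have Eu: "\<mu> w * X 1 + cnj (\<mu> w) * Y 1 = (x w - y w) * cnj (K 1)"
       "Re (\<mu> w * X 1 * cnj (x w - y w)) = 0"
    by (rule lightlike_direction_equations[where a = "\<alpha> w" and ?y1.0 = "Y 1" and ?m1.0 = "K 1"];
        use cu dF[of 1] in \<open>simp add: algebra_simps\<close>)+
  have Ev: "cnj (\<mu> w) * Y \<i> + cnj (cnj (\<mu> w)) * X \<i> = (y w - x w) * cnj (cnj (K \<i>))"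
       "Re (cnj (\<mu> w) * Y \<i> * cnj (y w - x w)) = 0"
    by (rule lightlike_direction_equations[where a = "\<beta> w" and ?y1.0 = "X \<i>" and ?m1.0 = "cnj (K \<i>)"];
        use cv dF[of \<i>] in \<open>simp add: algebra_simps\<close>)+
  have Kv: "K \<i> + cnj (K \<i>) = 2 * \<beta> w" and Ku: "cnj (K 1) + K 1 = 2 * \<alpha> w"
    using cv(1) dF(1)[of \<i>] cu(1) dF(1)[of 1] by (simp_all add: add.commute)
  have "mink (G \<i>) (\<nu> w) = - 2 * 1 * \<alpha> w * Im (\<mu> w * X \<i> * cnj (x w - y w))"
    by (rule mink_lightlike_derivative[where a' = "A \<i>"];
        use dG[of \<i>] c\<nu> in \<open>simp add: field_simps\<close>)
  then have Fx: "Im (\<mu> w * X \<i> * cnj (x w - y w)) = 0"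
    using bspec[OF mixed w] alpha unfolding p(2)[OF G] by simp
  \<comment> \<open>The exchanged form of the previous computation, with \<open>s = -1\<close>.\<close>
  have "mink (H 1) (\<nu> w) = - 2 * (-1) * \<beta> w * Im (cnj (\<mu> w) * Y 1 * cnj (y w - x w))"
    by (rule mink_lightlike_derivative[where a' = "B 1"];
        use dH[of 1] c\<nu> in \<open>simp add: field_simps\<close>)
  moreover have "H 1 = G \<i>"
    using mixed_partials_commute[OF \<open>open M\<close> f w] unfolding p(2)[OF G] p(1)[OF H] by simp
  ultimately have Fy: "Im (cnj (\<mu> w) * Y 1 * cnj (y w - x w)) = 0"
    using bspec[OF mixed w] beta unfolding p(2)[OF G] by simp
  have Ev': "cnj (\<mu> w) * Y \<i> + \<mu> w * X \<i> = (y w - x w) * K \<i>"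
    using Ev(1) by simp
  note nx = lightlike_pair_imaginary_ratio[OF xy mu beta Kv Eu(2) Ev' Ev(2) Fx]
  \<comment> \<open>The same facts with \<open>cnj \<mu>\<close> in the role of \<open>\<mu>\<close>, hence with doubled conjugations.\<close>
  have Eu': "cnj (cnj (\<mu> w)) * X 1 + cnj (\<mu> w) * Y 1 = (x w - y w) * cnj (K 1)"
    "Re (cnj (cnj (\<mu> w)) * X 1 * cnj (x w - y w)) = 0"
    "Im (cnj (cnj (\<mu> w)) * X \<i> * cnj (x w - y w)) = 0"
    "cnj (K 1) + cnj (cnj (K 1)) = 2 * \<alpha> w"
    using Eu Fx Ku by simp_all
  have yx: "y w \<noteq> x w" and mu': "cnj (\<mu> w) \<noteq> 0" using xy mu by auto
  note ny = lightlike_pair_imaginary_ratio[OF yx mu' alpha Eu'(4) Ev(2) Eu'(1,2) Fy]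
  show "dv x w \<noteq> 0" "Re (dv x w / du x w) = 0"
    using nx(1,2) unfolding p[OF X] by simp_all
  show "du y w \<noteq> 0" "Re (du y w / dv y w) = 0"
    using ny(1,2) unfolding p[OF Y] by simp_all
  have "N 1 = 0" if "X 1 = 0"
    by (rule gauss_map_stationary[OF xy Eu(1) Fy, where s = 1];
        use that dN[of 1] in \<open>simp add: field_simps\<close>)
  then show "du \<nu> w \<noteq> 0 \<Longrightarrow> du x w \<noteq> 0" unfolding p[OF X] p[OF N] by blast
  have "N \<i> = 0" if "Y \<i> = 0"
    by (rule gauss_map_stationary[OF yx Ev(1) Eu'(3), where s = "-1"];
        use that dN[of \<i>] in \<open>simp add: field_simps\<close>)
  then show "dv \<nu> w \<noteq> 0 \<Longrightarrow> dv y w \<noteq> 0" unfolding p[OF Y] p[OF N] by blast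
qed

theorem theorem6p2:
  fixes M :: "complex set"
    and f \<nu> :: "complex \<Rightarrow> real ^ 4"
    and \<alpha> \<beta> :: "complex \<Rightarrow> real"
    and x y \<mu> :: "complex \<Rightarrow> complex"
  assumes "open M" and "connected M" and "simply_connected M"
    and "isotropic_surface M f"
    and "gauss_map M f \<nu>"
    and "\<not> \<nu> constant_on M"
    and "standing_representation M f \<nu> \<alpha> \<beta> x y \<mu>"
    and "\<forall>w\<in>M. mink (dv (du f) w) (\<nu> w) = 0"
  shows "((\<forall>w\<in>M. du \<nu> w \<noteq> 0) \<longrightarrow>
           (\<exists>\<sigma>. Z_class_with M \<sigma> x \<and>
                cauchy_riemann_type M \<sigma> (\<lambda>w. Re (x w)) (\<lambda>w. Im (x w)))) \<and>
         ((\<forall>w\<in>M. dv \<nu> w \<noteq> 0) \<longrightarrow>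
           (\<exists>\<sigma>. Z_class_with M \<sigma> y \<and>
                cauchy_riemann_type M \<sigma> (\<lambda>w. Re (y w)) (\<lambda>w. Im (y w))))"
proof -
  have "smooth_on M \<nu>" using assms(5) by (simp add: gauss_map_def)
  note partials = zero_mean_curvature_partials[OF assms(1,4) this assms(7,8)]
  have "smooth_on M x" "smooth_on M y"
    using assms(7) by (auto simp: standing_representation_def)
  moreover have "Re (dv y w / du y w) = 0" if "w \<in> M" for w
  proof -
    have "Re (inverse c) = 0" if "Re c = 0" for c :: complex using that by simp
    from this[OF partials(5)[OF that]] show ?thesis by (simp only: inverse_divide)
  qed
  ultimately show ?thesis
    using imaginary_ratio_imp_Z_class[OF assms(1), of x]
      imaginary_ratio_imp_Z_class[OF assms(1), of y] partials
    by blast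
qed

end
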